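(* Let $\Pi$ be a hereditary graph property, and suppose that for an $n$-vertex graph $G$ every set $U\subseteq V(G)$ with $G[U]\in\Pi$ has an ordered fingerprint of length at most $q$ whose associated container has size at most $(1-\eta)n$; that is, there are maps $$f:\{U\subseteq V(G):G[U]\in\Pi\}\to\bigcup_{j=0}^{q}V(G)_{\neq}^{j},\qquad C:\operatorname{im}(f)\to\binom{V(G)}{\le(1-\eta)n},$$ such that every entry of $f(U)$ belongs to $U$ and $U\subseteq C(f(U))$ whenever $G[U]\in\Pi$. Then $$\bigl|\{U\subseteq V(G):G[U]\in\Pi\}\bigr|\le(q+1)n^q2^{(1-\eta)n}.$$ Moreover, for every integer $t$ with $q\le t\le n$, $$\frac{|\{U\in\binom{V(G)}{t}:G[U]\in\Pi\}|}{\binom nt}\le\sum_{j=0}^{q}t^j(1-\eta)^{t-j}.$$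
   Context: A graph is a finite simple labelled graph. A graph property is a family of graphs closed under isomorphism; it is hereditary if closed under taking induced subgraphs. Here $\eta>0$ is real and $q\ge0$ is an integer. $V_{\neq}^{j}$ denotes the ordered $j$-tuples of distinct elements of $V$; $\binom{V}{\le x}$ and $\binom{V}{t}$ denote the subsets of $V$ of size at most $x$, respectively exactly $t$.
   Formalization: The first bound is stated only when n ≥ 1 or q = 0 (it fails for n = 0 < q, as the empty set may be counted while n^q = 0); the second only when Π is nonempty or η ≤ 1 (for empty Π and η > 1 its right side can be negative). *)

theory Defs
  imports Complex_Main "HOL-Library.FuncSet" "Graph_Theory.Digraph_Isomorphism"
begin

text \<open>
  Finite simple graphs are the \<^locale>\<open>graph\<close>s of \<^theory>\<open>Graph_Theory.Digraph\<close>: finite, loopless,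
  symmetric digraphs without parallel arcs, an undirected edge being a pair of opposite arcs.
  On these, isomorphism is \<^const>\<open>digraph_iso\<close> and \<open>G[U]\<close> is \<open>G \<restriction> U\<close>. The graph with no
  vertices is allowed, so \<open>U = {}\<close> is among the sets considered.

  A property is a set of graphs over one vertex type and one arc type. Both types are arbitrary,
  so this covers isomorphism-closed classes of all finite graphs.

  The side conditions in the theorem exclude two degenerate cases in which the bounds fail. For
  \<open>n = 0 < q\<close> the factor \<open>n ^ q\<close> is 0, though \<open>U = {}\<close> may be counted. For an empty property and
  \<open>\<eta> > 1\<close> the hypotheses are vacuous, while the sum in the second bound can be negative.
\<close>

definition graph_property :: "('a, 'b) pre_digraph set \<Rightarrow> bool" where
  "graph_property P \<longleftrightarrow>
     (\<forall>G\<in>P. graph G) \<and> (\<forall>G\<in>P. \<forall>H. digraph_iso G H \<longrightarrow> H \<in> P)"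

definition hereditary_graph_property :: "('a, 'b) pre_digraph set \<Rightarrow> bool" where
  "hereditary_graph_property P \<longleftrightarrow>
     graph_property P \<and> (\<forall>G\<in>P. \<forall>S. S \<subseteq> verts G \<longrightarrow> G \<restriction> S \<in> P)"

definition inducing_sets :: "('a, 'b) pre_digraph set \<Rightarrow> ('a, 'b) pre_digraph \<Rightarrow> 'a set set" where
  "inducing_sets P G = {U. U \<subseteq> verts G \<and> G \<restriction> U \<in> P}"

definition distinct_tuples :: "'a set \<Rightarrow> nat \<Rightarrow> 'a list set" where
  "distinct_tuples V j = {xs. length xs = j \<and> distinct xs \<and> set xs \<subseteq> V}"

definition subsets_of_size_le :: "'a set \<Rightarrow> real \<Rightarrow> 'a set set" where
  "subsets_of_size_le V x = {S. S \<subseteq> V \<and> real (card S) \<le> x}"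

end

theory Submission
  imports Defs
begin

text \<open>
  Each counted set \<open>U\<close> is classified by its fingerprint \<open>S = f U\<close>, and is squeezed between the
  set of entries of \<open>S\<close> and the container \<open>C S\<close>. The first bound uses only \<open>U \<subseteq> C S\<close>: there are
  at most \<open>n ^ j \<le> n ^ q\<close> fingerprints of each length \<open>j \<le> q\<close>, and each container has at most
  \<open>2 powr ((1 - \<eta>) * n)\<close> subsets.

  For sets of size \<open>t\<close> both inclusions matter. A fingerprint of length \<open>j\<close> already accounts for
  \<open>j\<close> elements of \<open>U\<close>, so that at most \<open>(m - j) choose (t - j)\<close> sets share it, where \<open>m\<close> is the
  largest size that a container may have. There are \<open>fact j * (n choose j)\<close> possible fingerprints,
  and the identity \<open>(n choose j) * ((n - j) choose (t - j)) = (n choose t) * (t choose j)\<close> turns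
  this count, relative to \<open>n choose t\<close>, into \<open>fact j * (t choose j) \<le> t ^ j\<close> times the ratio of
  \<open>(m - j) choose (t - j)\<close> to \<open>(n - j) choose (t - j)\<close>. That ratio is a product of \<open>t - j\<close>
  fractions, each at most \<open>1 - \<eta>\<close> (lemma \<open>binomial_le_power_mult_binomial\<close>).

  Heredity enters through the empty graph: it belongs to every nonempty hereditary property,
  so the empty vertex set is then counted, its container exists, and \<open>(1 - \<eta>) * n\<close> cannot be
  negative.
\<close>

lemma card_distinct_tuples:
  assumes "finite V" "j \<le> card V"
  shows "card (distinct_tuples V j) = fact j * (card V choose j)"
proof -
  have "card (distinct_tuples V j) = \<Prod>{card V - j + 1..card V}"
    unfolding distinct_tuples_def using assms by (rule card_lists_distinct_length_eq)
  also have "\<dots> = fact (card V) div fact (card V - j)"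
    by (simp add: fact_div_fact)
  also have "\<dots> = fact j * (card V choose j)"
  proof -
    have "fact (card V) = fact (card V - j) * (fact j * (card V choose j))"
      using binomial_fact_lemma[OF assms(2)] by (simp add: mult_ac)
    then show ?thesis by simp
  qed
  finally show ?thesis .
qed

lemma finite_distinct_tuples: "finite V \<Longrightarrow> finite (distinct_tuples V j)"
  unfolding distinct_tuples_def
  by (rule finite_subset[OF _ finite_lists_length_eq[of V j]]) auto

lemma card_distinct_tuples_le:
  assumes "finite V"
  shows "card (distinct_tuples V j) \<le> card V ^ j"
proof -
  have "card (distinct_tuples V j) \<le> card {xs. set xs \<subseteq> V \<and> length xs = j}"
    unfolding distinct_tuples_def
    by (rule card_mono[OF finite_lists_length_eq[OF assms]]) auto
  then show ?thesis by (simp add: card_lists_length_eq[OF assms])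
qed

lemma card_sets_between_le:
  assumes "finite B" "A \<subseteq> B"
  shows "card {U. A \<subseteq> U \<and> U \<subseteq> B \<and> card U = t} \<le> (card B - card A) choose (t - card A)"
proof -
  let ?X = "{U. A \<subseteq> U \<and> U \<subseteq> B \<and> card U = t}"
  let ?Y = "{W. W \<subseteq> B - A \<and> card W = t - card A}"
  have "card ?X \<le> card ?Y"
  proof (rule card_inj_on_le[of "\<lambda>U. U - A"])
    show "inj_on (\<lambda>U. U - A) ?X" by (auto simp: inj_on_def)
    show "(\<lambda>U. U - A) ` ?X \<subseteq> ?Y"
      using assms by (auto simp: card_Diff_subset finite_subset)
    show "finite ?Y" using assms by auto
  qed
  also have "card ?Y = card (B - A) choose (t - card A)"
    using assms by (intro n_subsets) auto
  also have "card (B - A) = card B - card A"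
    using assms by (simp add: card_Diff_subset finite_subset)
  finally show ?thesis .
qed

text \<open>
  If \<open>k \<le> a\<close>, the quotient of the two binomial coefficients is the product of the fractions
  \<open>(a - i) / (b - i)\<close> for \<open>i < k\<close>; otherwise the left-hand side vanishes. As \<open>c \<le> 1\<close>, the bound \<open>a \<le> c * b\<close> survives lowering \<open>a\<close> and
  \<open>b\<close> by one, so each of these fractions is at most \<open>c\<close>.
\<close>
lemma binomial_le_power_mult_binomial:
  fixes c :: real
  assumes "0 \<le> c" "c \<le> 1" "real a \<le> c * real b"
  shows "real (a choose k) \<le> c ^ k * real (b choose k)"
  using assms(3)
proof (induction k arbitrary: a b)
  case 0
  then show ?case by simp
next
  case (Suc k)
  show ?case
  proof (cases "a = 0")
    case True
    then show ?thesis using assms(1) by simp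
  next
    case False
    with Suc.prems have "b \<noteq> 0" by (cases "b = 0") auto
    have "real (a - 1) \<le> c * real (b - 1)"
      using Suc.prems assms(2) False \<open>b \<noteq> 0\<close> by (simp add: of_nat_diff algebra_simps)
    then have IH: "real ((a - 1) choose k) \<le> c ^ k * real ((b - 1) choose k)"
      by (rule Suc.IH)
    have absorb: "real (Suc k) * real (x choose Suc k) = real x * real ((x - 1) choose k)" for x
      unfolding of_nat_mult[symmetric] by (simp only: binomial_absorption)
    have "real (Suc k) * real (a choose Suc k) = real a * real ((a - 1) choose k)"
      by (rule absorb)
    also have "\<dots> \<le> (c * real b) * (c ^ k * real ((b - 1) choose k))"
      using Suc.prems IH assms(1) by (intro mult_mono) auto
    also have "\<dots> = c ^ Suc k * (real b * real ((b - 1) choose k))"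
      by (simp add: algebra_simps)
    also have "\<dots> = real (Suc k) * (c ^ Suc k * real (b choose Suc k))"
      unfolding absorb[symmetric] by (rule mult.left_commute)
    finally show ?thesis by (simp del: power_Suc binomial_Suc_Suc)
  qed
qed

text \<open>
  Both bounds of the theorem are instances of this union bound over the fibres of \<open>f\<close>; only the
  bound \<open>b j\<close> on a fibre over a fingerprint of length \<open>j\<close> differs.
\<close>
lemma card_le_sum_fingerprints:
  fixes b :: "nat \<Rightarrow> real"
  assumes "finite V"
    and f: "f \<in> F \<rightarrow> (\<Union>j\<in>{0..q}. distinct_tuples V j)"
    and fibre: "\<And>j S. j \<le> q \<Longrightarrow> S \<in> distinct_tuples V j \<Longrightarrow> real (card {U \<in> F. f U = S}) \<le> b j"
    and "finite F"
  shows "real (card F) \<le> (\<Sum>j=0..q. real (card (distinct_tuples V j)) * b j)"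
proof -
  have "F = (\<Union>j\<in>{0..q}. \<Union>S\<in>distinct_tuples V j. {U \<in> F. f U = S})"
    using f by fastforce
  then have "card F = card (\<Union>j\<in>{0..q}. \<Union>S\<in>distinct_tuples V j. {U \<in> F. f U = S})"
    by simp
  also have "\<dots> \<le> (\<Sum>j=0..q. card (\<Union>S\<in>distinct_tuples V j. {U \<in> F. f U = S}))"
    by (rule card_UN_le) simp
  also have "\<dots> \<le> (\<Sum>j=0..q. \<Sum>S\<in>distinct_tuples V j. card {U \<in> F. f U = S})"
    by (intro sum_mono card_UN_le finite_distinct_tuples assms(1))
  finally have "real (card F) \<le> real (\<Sum>j=0..q. \<Sum>S\<in>distinct_tuples V j. card {U \<in> F. f U = S})"
    by (rule of_nat_mono)
  also have "\<dots> = (\<Sum>j=0..q. \<Sum>S\<in>distinct_tuples V j. real (card {U \<in> F. f U = S}))"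
    by simp
  also have "\<dots> \<le> (\<Sum>j=0..q. \<Sum>S\<in>distinct_tuples V j. b j)"
    by (intro sum_mono fibre) auto
  finally show ?thesis by simp
qed

lemma card_le_fingerprints_containers:
  fixes m :: real
  assumes "finite V"
    and F: "F \<subseteq> Pow V"
    and f: "f \<in> F \<rightarrow> (\<Union>j\<in>{0..q}. distinct_tuples V j)"
    and C: "C \<in> f ` F \<rightarrow> subsets_of_size_le V m"
    and sub: "\<And>U. U \<in> F \<Longrightarrow> U \<subseteq> C (f U)"
    and "card V \<ge> 1 \<or> q = 0"
  shows "real (card F) \<le> (real q + 1) * real (card V) ^ q * 2 powr m"
proof -
  have "finite F" using F assms(1) by (auto intro: finite_subset[of _ "Pow V"])
  have fibre: "real (card {U \<in> F. f U = S}) \<le> 2 powr m" for S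
  proof (cases "S \<in> f ` F")
    case True
    with C have CS: "C S \<subseteq> V" "real (card (C S)) \<le> m"
      by (auto simp: subsets_of_size_le_def)
    with assms(1) have fin: "finite (C S)" by (auto intro: finite_subset)
    have "card {U \<in> F. f U = S} \<le> card (Pow (C S))"
      using fin sub by (intro card_mono) auto
    then have "real (card {U \<in> F. f U = S}) \<le> real (2 ^ card (C S))"
      unfolding card_Pow[OF fin] by (rule of_nat_mono)
    also have "\<dots> = 2 powr real (card (C S))" by (simp add: powr_realpow)
    also have "\<dots> \<le> 2 powr m" using CS(2) by simp
    finally show ?thesis .
  next
    case False
    then have "{U \<in> F. f U = S} = {}" by auto
    then show ?thesis by (simp only: card.empty of_nat_0 powr_ge_zero)
  qed
  have "real (card F) \<le> (\<Sum>j=0..q. real (card (distinct_tuples V j)) * 2 powr m)"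
    using assms(1) f fibre \<open>finite F\<close> by (rule card_le_sum_fingerprints)
  also have "\<dots> \<le> (\<Sum>j=0..q. real (card V) ^ q * 2 powr m)"
  proof (intro sum_mono mult_right_mono)
    fix j assume "j \<in> {0..q}"
    then have "card V ^ j \<le> card V ^ q"
      using assms(6) by (auto intro: power_increasing)
    with card_distinct_tuples_le[OF assms(1), of j]
    have "card (distinct_tuples V j) \<le> card V ^ q" by linarith
    then show "real (card (distinct_tuples V j)) \<le> real (card V) ^ q"
      by (simp flip: of_nat_power)
  qed simp
  also have "\<dots> = (real q + 1) * real (card V) ^ q * 2 powr m"
    by (simp add: algebra_simps)
  finally show ?thesis .
qed

text \<open>
  Suppose that every tuple of length \<open>j\<close> has a container of size \<open>m\<close>. Divided by
  \<open>card V choose t\<close>, the left-hand side then bounds the expected number of pairs in which a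
  uniformly random \<open>t\<close>-set contains a tuple and lies in its container. The \<open>t\<close>-set has at most
  \<open>t ^ j\<close> ordered \<open>j\<close>-tuples of distinct elements, and given the tuple its other \<open>t - j\<close> elements
  all land in the container with probability at most \<open>c ^ (t - j)\<close>.
\<close>
lemma card_distinct_tuples_mult_binomial_le:
  fixes c :: real
  assumes "finite V" "0 \<le> c" "c \<le> 1" "real m \<le> c * real (card V)" "j \<le> t" "t \<le> card V"
  shows "real (card (distinct_tuples V j)) * real ((m - j) choose (t - j))
           \<le> real (card V choose t) * (real t ^ j * c ^ (t - j))"
proof -
  let ?n = "card V"
  have "real (m - j) \<le> c * real (?n - j)"
  proof (cases "j \<le> m")
    case True
    have "c * real j \<le> real j" using assms(3) by (simp add: mult_left_le_one_le assms(2))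
    then show ?thesis using True assms(4-6) by (simp add: of_nat_diff algebra_simps)
  next
    case False
    then show ?thesis using assms(2) by simp
  qed
  then have "real ((m - j) choose (t - j)) \<le> c ^ (t - j) * real ((?n - j) choose (t - j))"
    by (rule binomial_le_power_mult_binomial[OF assms(2,3)])
  then have "real (card (distinct_tuples V j)) * real ((m - j) choose (t - j))
      \<le> real (card (distinct_tuples V j)) * (c ^ (t - j) * real ((?n - j) choose (t - j)))"
    by (rule mult_left_mono) simp
  also have "\<dots> = c ^ (t - j) * (fact j * real ((?n choose j) * ((?n - j) choose (t - j))))"
    using assms by (simp add: card_distinct_tuples)
  also have "(?n choose j) * ((?n - j) choose (t - j)) = (?n choose t) * (t choose j)"
    using assms by (simp add: choose_mult)
  also have "c ^ (t - j) * (fact j * real ((?n choose t) * (t choose j)))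
      = real (?n choose t) * (real ((t choose j) * fact j) * c ^ (t - j))"
    by simp
  also have "\<dots> \<le> real (?n choose t) * (real (t ^ j) * c ^ (t - j))"
    using assms(2) binomial_fact_pow[of t j]
    by (intro mult_left_mono mult_right_mono of_nat_mono) auto
  finally show ?thesis by simp
qed

lemma card_uniform_le_fingerprints_containers:
  fixes c :: real
  assumes "finite V" "0 \<le> c" "c \<le> 1"
    and F: "F \<subseteq> Pow V"
    and f: "f \<in> F \<rightarrow> (\<Union>j\<in>{0..q}. distinct_tuples V j)"
    and C: "C \<in> f ` F \<rightarrow> subsets_of_size_le V (c * real (card V))"
    and fp: "\<And>U. U \<in> F \<Longrightarrow> set (f U) \<subseteq> U"
    and sub: "\<And>U. U \<in> F \<Longrightarrow> U \<subseteq> C (f U)"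
    and "q \<le> t" "t \<le> card V"
  shows "real (card {U \<in> F. card U = t}) / real (card V choose t)
           \<le> (\<Sum>j=0..q. real t ^ j * c ^ (t - j))"
proof -
  let ?n = "card V" and ?F = "{U \<in> F. card U = t}"
  define m where "m = nat \<lfloor>c * real ?n\<rfloor>"
  have m: "real m \<le> c * real ?n" using assms(2) by (simp add: m_def)
  have "finite ?F" using assms(1) F
    by (auto intro: finite_subset[of _ "Pow V"])
  have f': "f \<in> ?F \<rightarrow> (\<Union>j\<in>{0..q}. distinct_tuples V j)" using f by auto
  have fibre: "real (card {U \<in> ?F. f U = S}) \<le> real ((m - j) choose (t - j))"
    if S: "S \<in> distinct_tuples V j" for j S
  proof (cases "\<exists>U\<in>F. f U = S")
    case True
    then obtain U where U: "U \<in> F" "f U = S" by blast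
    have CS: "C S \<subseteq> V" "real (card (C S)) \<le> c * real ?n"
      using funcset_mem[OF C, of S] U by (auto simp: subsets_of_size_le_def)
    have SC: "set S \<subseteq> C S" using fp[OF U(1)] sub[OF U(1)] U(2) by auto
    have fin: "finite (C S)" using CS(1) assms(1) by (rule finite_subset)
    have "card (C S) \<le> m" using CS(2) by (simp add: m_def le_nat_floor)
    have len: "card (set S) = j" using S by (auto simp: distinct_tuples_def distinct_card)
    have "card {U \<in> ?F. f U = S} \<le> card {U. set S \<subseteq> U \<and> U \<subseteq> C S \<and> card U = t}"
      using fin fp sub by (intro card_mono) auto
    also have "\<dots> \<le> (card (C S) - j) choose (t - j)"
      using card_sets_between_le[OF fin SC] len by simp
    also have "\<dots> \<le> (m - j) choose (t - j)"
      using \<open>card (C S) \<le> m\<close> by (intro binomial_right_mono) simp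
    finally show ?thesis by simp
  next
    case False
    then have "{U \<in> ?F. f U = S} = {}" by auto
    then show ?thesis by (simp only: card.empty)
  qed
  have "real (card ?F) \<le> (\<Sum>j=0..q. real (card (distinct_tuples V j)) * real ((m - j) choose (t - j)))"
    using assms(1) f' fibre \<open>finite ?F\<close> by (rule card_le_sum_fingerprints)
  also have "\<dots> \<le> (\<Sum>j=0..q. real (?n choose t) * (real t ^ j * c ^ (t - j)))"
    using assms m by (intro sum_mono card_distinct_tuples_mult_binomial_le) auto
  also have "\<dots> = real (?n choose t) * (\<Sum>j=0..q. real t ^ j * c ^ (t - j))"
    by (simp add: sum_distrib_left)
  finally show ?thesis
    using assms by (simp add: divide_le_eq mult.commute)
qed

text \<open>
  All graphs without vertices are isomorphic: an isomorphism may prescribe the tail and head maps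
  of its target freely when there are no arcs.
\<close>
lemma empty_in_inducing_sets:
  assumes "hereditary_graph_property P" "P \<noteq> {}"
  shows "{} \<in> inducing_sets P G"
proof -
  from assms(2) obtain H where H: "H \<in> P" by auto
  then have HP: "H \<restriction> {} \<in> P"
    using assms(1) unfolding hereditary_graph_property_def by blast
  define \<phi> where "\<phi> = \<lparr>iso_verts = id, iso_arcs = id, iso_head = head G, iso_tail = tail G\<rparr>"
  have "graph H"
    using assms(1) H by (auto simp: hereditary_graph_property_def graph_property_def)
  then have "digraph_iso (H \<restriction> {}) (G \<restriction> {})"
    unfolding digraph_iso_def
    by (intro exI[of _ \<phi>])
       (auto simp: \<phi>_def pre_digraph.digraph_isomorphism_def app_iso_def induce_subgraph_def
          wf_digraph_def)
  then show ?thesis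
    using HP assms(1)
    by (auto simp: inducing_sets_def hereditary_graph_property_def graph_property_def)
qed

theorem corollary7p1:
  fixes P :: "('a, 'b) pre_digraph set"
    and G :: "('a, 'b) pre_digraph"
    and n q :: nat
    and \<eta> :: real
    and f :: "'a set \<Rightarrow> 'a list"
    and C :: "'a list \<Rightarrow> 'a set"
  assumes "hereditary_graph_property P"
    and "graph G" and "card (verts G) = n"
    and "\<eta> > 0"
    and "f \<in> inducing_sets P G \<rightarrow> (\<Union>j\<in>{0..q}. distinct_tuples (verts G) j)"
    and "C \<in> f ` inducing_sets P G \<rightarrow> subsets_of_size_le (verts G) ((1 - \<eta>) * real n)"
    and "\<And>U. U \<in> inducing_sets P G \<Longrightarrow> set (f U) \<subseteq> U"
    and "\<And>U. U \<in> inducing_sets P G \<Longrightarrow> U \<subseteq> C (f U)"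
  shows "(n \<ge> 1 \<or> q = 0 \<longrightarrow>
            real (card (inducing_sets P G)) \<le> (real q + 1) * real n ^ q * 2 powr ((1 - \<eta>) * real n))
       \<and> (P \<noteq> {} \<or> \<eta> \<le> 1 \<longrightarrow>
            (\<forall>t. q \<le> t \<and> t \<le> n \<longrightarrow>
              real (card {U \<in> inducing_sets P G. card U = t}) / real (n choose t)
                \<le> (\<Sum>j=0..q. real t ^ j * (1 - \<eta>) ^ (t - j))))"
proof -
  let ?I = "inducing_sets P G"
  have finV: "finite (verts G)"
  proof -
    interpret graph G by fact
    show ?thesis by (rule finite_verts)
  qed
  have I: "?I \<subseteq> Pow (verts G)" by (auto simp: inducing_sets_def)
  have first: "real (card ?I) \<le> (real q + 1) * real n ^ q * 2 powr ((1 - \<eta>) * real n)"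
    if "n \<ge> 1 \<or> q = 0"
    using card_le_fingerprints_containers[OF finV I assms(5,6,8)] that assms(3) by simp
  have second: "real (card {U \<in> ?I. card U = t}) / real (n choose t)
      \<le> (\<Sum>j=0..q. real t ^ j * (1 - \<eta>) ^ (t - j))"
    if P: "P \<noteq> {} \<or> \<eta> \<le> 1" and t: "q \<le> t" "t \<le> n" for t
  proof (cases "\<eta> \<le> 1")
    case True
    with assms(4) have "0 \<le> 1 - \<eta>" "1 - \<eta> \<le> 1" by auto
    with card_uniform_le_fingerprints_containers[OF finV _ _ I assms(5) _ assms(7,8), of "1 - \<eta>" t]
    show ?thesis using assms(3,6) t by simp
  next
    \<comment> \<open>The container of the empty set has nonnegative size, so \<open>\<eta> > 1\<close> leaves only \<open>n = 0\<close>.\<close>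
    case False
    with P have "{} \<in> ?I" using empty_in_inducing_sets assms(1) by blast
    then have "C (f {}) \<in> subsets_of_size_le (verts G) ((1 - \<eta>) * real n)"
      by (intro funcset_mem[OF assms(6)] imageI)
    then have "real (card (C (f {}))) \<le> (1 - \<eta>) * real n"
      by (simp add: subsets_of_size_le_def)
    then have "0 \<le> (1 - \<eta>) * real n"
      by (rule order_trans[OF of_nat_0_le_iff])
    with False have "n = 0" by (simp add: zero_le_mult_iff)
    with t have "q = 0" "t = 0" by auto
    have "verts G = {}" using finV assms(3) \<open>n = 0\<close> by simp
    then have "card {U \<in> ?I. card U = t} \<le> card {{} :: 'a set}"
      using I by (intro card_mono) auto
    then show ?thesis using \<open>n = 0\<close> \<open>q = 0\<close> \<open>t = 0\<close> by simp
  qed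
  from first second show ?thesis by blast
qed

end
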